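(* Let $m,n\ge 1$ be integers, at least one of which is even. Then $$\gamma_1^{\mathrm L}(P_m\square P_n)=\frac{mn}{2}.$$
   Context: All graphs are finite and simple; $N_G(u)$ is the open neighborhood of $u$ in $G$, and $P_n$ is the path on $n$ vertices. A set $D\subseteq V(G)$ is a dominating set if every vertex of $V(G)\setminus D$ has a neighbor in $D$. A dominating set $D$ of $G$ is a $1$-limited dominating set if $|N_G(u)\setminus D|\le 1$ for every $u\in D$. The $1$-limited domination number $\gamma_1^{\mathrm L}(G)$ is the minimum cardinality of a $1$-limited dominating set of $G$. The Cartesian product $G\square H$ has vertex set $V(G)\times V(H)$, with $(g,h)$ and $(g',h')$ adjacent if and only if either $g=g'$ and $hh'\in E(H)$, or $h=h'$ and $gg'\in E(G)$. *)

theory Defs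
  imports Complex_Main "Graph_Theory.Pair_Digraph"
begin

text \<open>
  A finite simple graph is a \<open>pair_graph\<close>: a finite vertex set with a symmetric,
  loop-free set of arcs; an edge \<open>uv\<close> is the pair of arcs \<open>(u, v)\<close> and \<open>(v, u)\<close>.
\<close>

definition neighborhood :: "'a pair_pre_digraph \<Rightarrow> 'a \<Rightarrow> 'a set" where
  "neighborhood G u = {v. (u, v) \<in> parcs G}"

definition dominating_set :: "'a pair_pre_digraph \<Rightarrow> 'a set \<Rightarrow> bool" where
  "dominating_set G D \<longleftrightarrow>
     D \<subseteq> pverts G \<and> (\<forall>v \<in> pverts G - D. neighborhood G v \<inter> D \<noteq> {})"

definition limited_dominating_set :: "nat \<Rightarrow> 'a pair_pre_digraph \<Rightarrow> 'a set \<Rightarrow> bool" where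
  "limited_dominating_set k G D \<longleftrightarrow>
     dominating_set G D \<and> (\<forall>u \<in> D. card (neighborhood G u - D) \<le> k)"

definition limited_domination_number :: "nat \<Rightarrow> 'a pair_pre_digraph \<Rightarrow> nat" where
  "limited_domination_number k G = (LEAST c. \<exists>D. limited_dominating_set k G D \<and> card D = c)"

definition path_graph :: "nat \<Rightarrow> nat pair_pre_digraph" where
  "path_graph n =
     \<lparr> pverts = {1..n},
       parcs = {(i, j). i \<in> {1..n} \<and> j \<in> {1..n} \<and> (j = i + 1 \<or> i = j + 1)} \<rparr>"

definition cartesian_product ::
    "'a pair_pre_digraph \<Rightarrow> 'b pair_pre_digraph \<Rightarrow> ('a \<times> 'b) pair_pre_digraph" where
  "cartesian_product G H =
     \<lparr> pverts = pverts G \<times> pverts H,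
       parcs = {((g, h), (g', h')) | g h g' h'.
                  (g, h) \<in> pverts G \<times> pverts H \<and> (g', h') \<in> pverts G \<times> pverts H \<and>
                  ((g = g' \<and> (h, h') \<in> parcs H) \<or> (h = h' \<and> (g, g') \<in> parcs G))} \<rparr>"

lemma pair_graph_path_graph: "pair_graph (path_graph n)"
proof
  show "finite (parcs (path_graph n))"
    by (rule finite_subset[of _ "{1..n} \<times> {1..n}"]) (auto simp: path_graph_def)
qed (auto simp: path_graph_def symmetric_def sym_def)

lemma pair_graph_cartesian_product:
  assumes "pair_graph G" "pair_graph H"
  shows "pair_graph (cartesian_product G H)"
proof -
  interpret G: pair_graph G by fact
  interpret H: pair_graph H by fact
  have sym: "sym (parcs G)" "sym (parcs H)"
    using G.pair_sym_arcs H.pair_sym_arcs by (simp_all add: symmetric_def)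
  show ?thesis
  proof
    show "finite (parcs (cartesian_product G H))"
      by (rule finite_subset[of _ "(pverts G \<times> pverts H) \<times> (pverts G \<times> pverts H)"])
         (auto simp: cartesian_product_def G.pair_finite_verts H.pair_finite_verts)
    show "symmetric (with_proj (cartesian_product G H))"
      using sym unfolding symmetric_def
      by (auto simp: cartesian_product_def sym_def)
  qed (use G.pair_no_loops H.pair_no_loops in
       \<open>force simp: cartesian_product_def G.pair_finite_verts H.pair_finite_verts\<close>)+
qed

lemma limited_dominating_set_pverts:
  assumes "pair_graph G"
  shows "limited_dominating_set k G (pverts G)"
proof -
  interpret pair_graph G by fact
  have no_outside: "neighborhood G u - pverts G = {}" for u
    by (auto simp: neighborhood_def dest: in_arcsD2)
  show ?thesis
    unfolding limited_dominating_set_def dominating_set_def no_outside by simp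
qed

lemma limited_domination_number_attained:
  assumes "pair_graph G"
  shows "\<exists>D. limited_dominating_set k G D \<and> card D = limited_domination_number k G"
  unfolding limited_domination_number_def
  by (rule LeastI_ex) (use limited_dominating_set_pverts[OF assms] in blast)

end

(* The lower bound is a count: every vertex outside D lies in N(u) - D for some u in D, and each of
   these sets has at most one element, so |V - D| <= |D|.  For the upper bound let m be even, say.
   The indices congruent to 2 or 3 modulo 4 form a 1-limited dominating set of P_m with m/2 elements
   (pattern: out, in, in, out, ...), and multiplying it by V(P_n) creates no new outside
   neighbors. *)
theory Submission
  imports Defs
begin

lemma card_pverts_le_limited_dominating_set:
  assumes "pair_graph G" and D: "limited_dominating_set k G D"
  shows "card (pverts G) \<le> (k + 1) * card D"
proof -
  interpret pair_graph G by fact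
  have sub: "D \<subseteq> pverts G"
    and dom: "\<And>v. v \<in> pverts G - D \<Longrightarrow> neighborhood G v \<inter> D \<noteq> {}"
    and lim: "\<And>u. u \<in> D \<Longrightarrow> card (neighborhood G u - D) \<le> k"
    using D by (auto simp: limited_dominating_set_def dominating_set_def)
  have fin: "finite D"
    using sub by (rule finite_subset) simp
  have sym: "(v, u) \<in> parcs G" if "(u, v) \<in> parcs G" for u v
    using pair_sym_arcs that by (auto simp: symmetric_def dest: symD)
  have "finite (neighborhood G u)" for u
    by (rule finite_subset[OF _ pair_finite_verts]) (auto simp: neighborhood_def dest: in_arcsD2)
  then have "finite (\<Union>u\<in>D. neighborhood G u - D)"
    using fin by blast
  \<comment> \<open>Domination yields an arc from an outside vertex \<open>v\<close> to some
    \<open>u\<close> in \<open>D\<close>. By symmetry its reverse is an arc too, so \<open>v\<close>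
    lies in \<open>neighborhood G u - D\<close>.\<close>
  moreover have "pverts G - D \<subseteq> (\<Union>u\<in>D. neighborhood G u - D)"
    using dom sym by (fastforce simp: neighborhood_def)
  ultimately have "card (pverts G - D) \<le> card (\<Union>u\<in>D. neighborhood G u - D)"
    by (rule card_mono)
  also have "\<dots> \<le> (\<Sum>u\<in>D. card (neighborhood G u - D))"
    using fin by (rule card_UN_le)
  also have "\<dots> \<le> card D * k"
    using sum_bounded_above[of D "\<lambda>u. card (neighborhood G u - D)" k] lim by simp
  finally have "card (pverts G - D) \<le> card D * k" .
  moreover have "card (pverts G) = card D + card (pverts G - D)"
    using card_Diff_subset[OF fin sub] card_mono[OF pair_finite_verts sub] by simp
  ultimately show ?thesis
    by (simp add: algebra_simps)
qed

text \<open>A move along \<open>H\<close> fixes the first coordinate and so stays inside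
  \<open>D \<times> pverts H\<close>. The outside neighbors of \<open>(g, h)\<close> therefore come
  from moves along \<open>G\<close> alone, a copy of those of \<open>g\<close> in the layer of
  \<open>h\<close>; domination also takes place within that layer.\<close>

lemma limited_dominating_set_cartesian_product_left:
  assumes "pair_graph G" and D: "limited_dominating_set k G D"
  shows "limited_dominating_set k (cartesian_product G H) (D \<times> pverts H)"
proof -
  interpret pair_graph G by fact
  have "card (neighborhood (cartesian_product G H) (g, h) - D \<times> pverts H) \<le> k" if "g \<in> D" for g h
  proof -
    have "finite (neighborhood G g - D)"
      by (rule finite_subset[OF _ pair_finite_verts]) (auto simp: neighborhood_def dest: in_arcsD2)
    moreover have "neighborhood (cartesian_product G H) (g, h) - D \<times> pverts H
        \<subseteq> (\<lambda>g'. (g', h)) ` (neighborhood G g - D)"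
      using that by (auto simp: neighborhood_def cartesian_product_def)
    ultimately have "card (neighborhood (cartesian_product G H) (g, h) - D \<times> pverts H)
        \<le> card (neighborhood G g - D)"
      by (rule surj_card_le)
    then show ?thesis
      using D that by (fastforce simp: limited_dominating_set_def)
  qed
  moreover have "neighborhood (cartesian_product G H) (g, h) \<inter> D \<times> pverts H \<noteq> {}"
    if "(g, h) \<in> pverts (cartesian_product G H) - D \<times> pverts H" for g h
  proof -
    have gh: "g \<in> pverts G" "h \<in> pverts H" "g \<notin> D"
      using that by (auto simp: cartesian_product_def)
    then obtain g' where "g' \<in> D" "(g, g') \<in> parcs G" "g' \<in> pverts G"
      using D by (fastforce simp: limited_dominating_set_def dominating_set_def neighborhood_def)
    then have "(g', h) \<in> neighborhood (cartesian_product G H) (g, h) \<inter> D \<times> pverts H"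
      using gh by (simp add: neighborhood_def cartesian_product_def)
    then show ?thesis by blast
  qed
  moreover have "D \<times> pverts H \<subseteq> pverts (cartesian_product G H)"
    using D by (auto simp: limited_dominating_set_def dominating_set_def cartesian_product_def)
  ultimately show ?thesis
    unfolding limited_dominating_set_def dominating_set_def by (safe; blast)
qed

text \<open>The mirror image with the two coordinates exchanged, for the case in which the second
  path has even order.\<close>

lemma limited_dominating_set_cartesian_product_right:
  assumes "pair_graph H" and D: "limited_dominating_set k H D"
  shows "limited_dominating_set k (cartesian_product G H) (pverts G \<times> D)"
proof -
  interpret pair_graph H by fact
  have "card (neighborhood (cartesian_product G H) (g, h) - pverts G \<times> D) \<le> k" if "h \<in> D" for g h
  proof -
    have "finite (neighborhood H h - D)"
      by (rule finite_subset[OF _ pair_finite_verts]) (auto simp: neighborhood_def dest: in_arcsD2)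
    moreover have "neighborhood (cartesian_product G H) (g, h) - pverts G \<times> D
        \<subseteq> Pair g ` (neighborhood H h - D)"
      using that by (auto simp: neighborhood_def cartesian_product_def)
    ultimately have "card (neighborhood (cartesian_product G H) (g, h) - pverts G \<times> D)
        \<le> card (neighborhood H h - D)"
      by (rule surj_card_le)
    then show ?thesis
      using D that by (fastforce simp: limited_dominating_set_def)
  qed
  moreover have "neighborhood (cartesian_product G H) (g, h) \<inter> pverts G \<times> D \<noteq> {}"
    if "(g, h) \<in> pverts (cartesian_product G H) - pverts G \<times> D" for g h
  proof -
    have gh: "g \<in> pverts G" "h \<in> pverts H" "h \<notin> D"
      using that by (auto simp: cartesian_product_def)
    then obtain h' where "h' \<in> D" "(h, h') \<in> parcs H" "h' \<in> pverts H"
      using D by (fastforce simp: limited_dominating_set_def dominating_set_def neighborhood_def)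
    then have "(g, h') \<in> neighborhood (cartesian_product G H) (g, h) \<inter> pverts G \<times> D"
      using gh by (simp add: neighborhood_def cartesian_product_def)
    then show ?thesis by blast
  qed
  moreover have "pverts G \<times> D \<subseteq> pverts (cartesian_product G H)"
    using D by (auto simp: limited_dominating_set_def dominating_set_def cartesian_product_def)
  ultimately show ?thesis
    unfolding limited_dominating_set_def dominating_set_def by (safe; blast)
qed

text \<open>If \<open>n mod 4 = 2\<close>, the last pair is cut down to the single vertex
  \<open>n\<close>, which still dominates \<open>n - 1\<close>.\<close>

definition path_pairs :: "nat \<Rightarrow> nat set" where
  "path_pairs n = {i \<in> {1..n}. i mod 4 = 2 \<or> i mod 4 = 3}"

lemma card_path_pairs: "card (path_pairs (2 * k)) = k"
proof (induction k)
  case 0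
  then show ?case by (simp add: path_pairs_def)
next
  case (Suc k)
  \<comment> \<open>The residues modulo 4 of the two new indices are 1, 2 for even \<open>k\<close>
    and 3, 0 for odd \<open>k\<close>, so exactly one of them joins the set.\<close>
  let ?x = "if even k then 2 * k + 2 else 2 * k + 1"
  have mods: "(2 * k + 1) mod 4 = (if even k then 1 else 3)"
    "(2 * k + 2) mod 4 = (if even k then 2 else 0)"
    by presburger+
  have "i \<in> path_pairs (2 * Suc k) \<longleftrightarrow> i \<in> insert ?x (path_pairs (2 * k))" for i
  proof -
    consider "i \<le> 2 * k" | "i = 2 * k + 1" | "i = 2 * k + 2" | "i > 2 * k + 2"
      by linarith
    then show ?thesis
      using mods by cases (auto simp: path_pairs_def split: if_splits)
  qed
  then have "path_pairs (2 * Suc k) = insert ?x (path_pairs (2 * k))"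
    by blast
  moreover have "?x \<notin> path_pairs (2 * k)" and "finite (path_pairs (2 * k))"
    by (auto simp: path_pairs_def)
  ultimately show ?case
    using Suc.IH by simp
qed

lemma limited_dominating_set_path_pairs:
  assumes "even n"
  shows "limited_dominating_set 1 (path_graph n) (path_pairs n)"
proof -
  have "neighborhood (path_graph n) i \<inter> path_pairs n \<noteq> {}" if "i \<in> {1..n} - path_pairs n" for i
  proof -
    have i: "1 \<le> i" "i \<le> n" "i mod 4 = 0 \<or> i mod 4 = 1"
      using that by (auto simp: path_pairs_def)
    have "\<exists>j. 1 \<le> j \<and> j \<le> n \<and> (j = i + 1 \<or> i = j + 1) \<and> (j mod 4 = 2 \<or> j mod 4 = 3)"
      using i(3)
    proof
      assume "i mod 4 = 0"
      moreover obtain j where j: "i = Suc j"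
        using i(1) by (cases i) auto
      ultimately have "j mod 4 = 3"
        by (simp add: mod_Suc split: if_splits)
      \<comment> \<open>Splitting on \<open>j\<close> excludes \<open>j = 0\<close>, whose residue
        is not 3; hence the predecessor of \<open>i\<close> is a vertex of the path.\<close>
      then show ?thesis
        using i(2) j by (intro exI[of _ j]) (cases j; auto)
    next
      assume "i mod 4 = 1"
      \<comment> \<open>Parity protects the right end: \<open>i\<close> is odd and \<open>n\<close>
        is even, so the successor of \<open>i\<close> still lies on the path and can dominate
        it.\<close>
      then have "i \<noteq> n" "(i + 1) mod 4 = 2"
        using assms by presburger+
      then show ?thesis
        using i(2) by (intro exI[of _ "i + 1"]) simp
    qed
    then obtain j where "j \<in> neighborhood (path_graph n) i \<inter> path_pairs n"
      using i unfolding neighborhood_def path_graph_def path_pairs_def by auto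
    then show ?thesis by blast
  qed
  moreover have "card (neighborhood (path_graph n) i - path_pairs n) \<le> 1"
    if "i \<in> path_pairs n" for i
  proof -
    have i: "i mod 4 = 2 \<or> i mod 4 = 3"
      using that by (simp add: path_pairs_def)
    \<comment> \<open>One side of \<open>i\<close> holds its partner in the pair, or lies beyond the
      end of the path. Only the other side, below for residue 2 and above for residue 3, can be
      outside the set.\<close>
    have "j = (if i mod 4 = 2 then i - 1 else i + 1)"
      if j: "j \<in> neighborhood (path_graph n) i - path_pairs n" for j
    proof -
      have "j = i + 1 \<or> i = j + 1" "j mod 4 \<noteq> 2" "j mod 4 \<noteq> 3"
        using j by (auto simp: neighborhood_def path_graph_def path_pairs_def)
      then show ?thesis
        using i by (auto simp: mod_Suc split: if_splits)
    qed
    then have sub: "neighborhood (path_graph n) i - path_pairs n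
        \<subseteq> {if i mod 4 = 2 then i - 1 else i + 1}"
      by blast
    then show ?thesis
      using card_mono[OF _ sub] by simp
  qed
  ultimately show ?thesis
    by (auto simp: limited_dominating_set_def dominating_set_def path_graph_def path_pairs_def)
qed

theorem lemma13:
  fixes m n :: nat
  assumes "m \<ge> 1" and "n \<ge> 1" and "even m \<or> even n"
  shows "real (limited_domination_number 1 (cartesian_product (path_graph m) (path_graph n)))
           = real m * real n / 2"
proof -
  let ?G = "cartesian_product (path_graph m) (path_graph n)"
  have G: "pair_graph ?G"
    by (intro pair_graph_cartesian_product pair_graph_path_graph)
  \<comment> \<open>Stating the size in doubled form keeps the argument in the natural numbers; the
    division by 2 appears only at the end, over the reals.\<close>
  have "\<exists>D. limited_dominating_set 1 ?G D \<and> 2 * card D = m * n"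
    using assms(3)
  proof
    assume "even m"
    then obtain k where "m = 2 * k" ..
    then show ?thesis
      using limited_dominating_set_cartesian_product_left[OF pair_graph_path_graph
          limited_dominating_set_path_pairs[OF \<open>even m\<close>], of "path_graph n"]
      by (intro exI conjI) (assumption, simp add: card_path_pairs card_cartesian_product path_graph_def)
  next
    assume "even n"
    then obtain k where "n = 2 * k" ..
    then show ?thesis
      using limited_dominating_set_cartesian_product_right[OF pair_graph_path_graph
          limited_dominating_set_path_pairs[OF \<open>even n\<close>], of "path_graph m"]
      by (intro exI conjI) (assumption, simp add: card_path_pairs card_cartesian_product path_graph_def)
  qed
  then obtain D where D: "limited_dominating_set 1 ?G D" "2 * card D = m * n"
    by blast
  have "limited_domination_number 1 ?G \<le> card D"
    unfolding limited_domination_number_def using D(1) by (blast intro: Least_le)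
  \<comment> \<open>The counting bound applies to a given set, so it is used on one that attains the
    minimum; with \<open>k = 1\<close> its factor is 2.\<close>
  moreover obtain E where E: "limited_dominating_set 1 ?G E"
    "card E = limited_domination_number 1 ?G"
    using limited_domination_number_attained[OF G] by blast
  moreover have "m * n \<le> 2 * card E"
    using card_pverts_le_limited_dominating_set[OF G E(1)]
    by (simp add: cartesian_product_def path_graph_def card_cartesian_product)
  ultimately have "2 * limited_domination_number 1 ?G = m * n"
    using D(2) by linarith
  then have "2 * real (limited_domination_number 1 ?G) = real m * real n"
    by (metis of_nat_mult of_nat_numeral)
  then show ?thesis
    by simp
qed

end
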